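(* Let $X$ be a real or complex Banach space with a normalized unconditional Schauder basis $\{e_j\}$ with unconditional basis constant $1$. Suppose that $X^*$ (a Banach lattice in the order induced by the basis) is uniformly monotone with modulus of monotonicity $M$. Then $X^*$ admits a uniformly simultaneously continuous retraction with modulus of continuity $2M^{-1}$; that is, there is a map $\varphi: X^*\to B_{X^*}$ which is the identity on $B_{X^*}$, is weak-$*$ continuous, is uniformly continuous in the norm, and satisfies $\omega_\varphi(t)\le 2M^{-1}(t)$ for all $t>0$.
   Context: $B_{X^*}$ is the closed unit ball of $X^*$. A retraction from $X^*$ onto $B_{X^*}$ is a continuous map $r:X^*\to B_{X^*}$ which is the identity on $B_{X^*}$. $X^*$ is said to admit a uniformly simultaneously continuous retraction if there is a retraction $r:X^*\to B_{X^*}$ which is both weak-$*$ continuous (weak-$*$ to weak-$*$) and uniformly continuous in the norm. When $X$ has a normalized unconditional basis $\{e_j\}$ with unconditional basis constant $1$, each $x^*\in X^*$ is identified with its coordinates $x^*(j)=\langle x^*,e_j\rangle$, and $X$ and $X^*$ are Banach lattices with coordinatewise order; in particular $|x^*|$ is the functional with coordinates $|x^*(j)|$. A Banach lattice $Z$ is uniformly monotone if for every $\varepsilon>0$ $$M(\varepsilon)=\inf\{\|\,|x|+|y|\,\|-1 : x,y\in Z,\ \|x\|=1,\ \|y\|\ge \varepsilon\}>0,$$ and $M$ is called its modulus of monotonicity. For $t\ge0$, $M^{-1}(t)=\sup\{\varepsilon\ge 0: M(\varepsilon)\le t\}$. The modulus of continuity of a map $\varphi$ on $X^*$ is $$\omega_\varphi(t)=\sup\{\|\varphi(x^*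 )-\varphi(y^* )\| : \|x^*-y^*\|\le t\}.$$ *)

theory Defs
  imports "HOL-Analysis.Analysis"
begin

(* The scalar field 'k is a commutative normed division algebra over the reals, so by
   Gelfand-Mazur it is isometrically isomorphic to the reals or to the complex numbers, and
   both are instances of the class. A real or complex Banach space is a type of class banach
   with a scalar multiplication sc extending its real one. *)
locale banach_space_over = vector_space sc
  for sc :: "'k::real_normed_field \<Rightarrow> 'a::banach \<Rightarrow> 'a" +
  assumes sc_of_real: "sc (of_real r) x = r *\<^sub>R x"
    and norm_sc: "norm (sc c x) = norm c * norm x"

definition schauder_basis :: "('k::real_normed_field \<Rightarrow> 'a::banach \<Rightarrow> 'a) \<Rightarrow> (nat \<Rightarrow> 'a) \<Rightarrow> bool" where
  "schauder_basis sc e \<longleftrightarrow> (\<forall>x. \<exists>!a. (\<lambda>j. sc (a j) (e j)) sums x)"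

definition unconditional_basis :: "('k::real_normed_field \<Rightarrow> 'a::banach \<Rightarrow> 'a) \<Rightarrow> (nat \<Rightarrow> 'a) \<Rightarrow> bool" where
  "unconditional_basis sc e \<longleftrightarrow> schauder_basis sc e \<and>
     (\<forall>x a. (\<lambda>j. sc (a j) (e j)) sums x \<longrightarrow> ((\<lambda>j. sc (a j) (e j)) has_sum x) UNIV)"

(* The supremum of the norms of the operators multiplying the coordinates by unimodular scalars.
   Over the complex numbers all unimodular scalars (not only signs) are needed for constant 1 to
   mean that the norm depends only on the moduli of the coordinates.
   The value is in ereal, so that no boundedness is presupposed. *)
definition unconditional_basis_constant ::
    "('k::real_normed_field \<Rightarrow> 'a::banach \<Rightarrow> 'a) \<Rightarrow> (nat \<Rightarrow> 'a) \<Rightarrow> ereal" where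
  "unconditional_basis_constant sc e =
     Sup {ereal (norm (\<Sum>j<n. sc (\<theta> j * a j) (e j))) | n \<theta> a.
            (\<forall>j. norm (\<theta> j) = 1) \<and> norm (\<Sum>j<n. sc (a j) (e j)) \<le> 1}"

(* Blinfuns are only real-linear. *)
definition dual_space :: "('k::real_normed_field \<Rightarrow> 'a::banach \<Rightarrow> 'a) \<Rightarrow> ('a \<Rightarrow>\<^sub>L 'k) set" where
  "dual_space sc = {f. \<forall>c x. blinfun_apply f (sc c x) = c * blinfun_apply f x}"

definition dual_ball :: "('k::real_normed_field \<Rightarrow> 'a::banach \<Rightarrow> 'a) \<Rightarrow> ('a \<Rightarrow>\<^sub>L 'k) set" where
  "dual_ball sc = {f \<in> dual_space sc. norm f \<le> 1}"

(* For scalar-valued maps the strong operator topology is pointwise convergence on 'a. *)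
definition weak_star_topology :: "('k::real_normed_field \<Rightarrow> 'a::banach \<Rightarrow> 'a) \<Rightarrow> ('a \<Rightarrow>\<^sub>L 'k) topology" where
  "weak_star_topology sc = subtopology strong_operator_topology (dual_space sc)"

(* The functional |f|. It exists when e has unconditional basis constant 1, and it is unique
   because the span of e is dense. *)
definition dual_abs ::
    "('k::real_normed_field \<Rightarrow> 'a::banach \<Rightarrow> 'a) \<Rightarrow> (nat \<Rightarrow> 'a) \<Rightarrow> ('a \<Rightarrow>\<^sub>L 'k) \<Rightarrow> ('a \<Rightarrow>\<^sub>L 'k)" where
  "dual_abs sc e f =
     (THE g. g \<in> dual_space sc \<and> (\<forall>j. blinfun_apply g (e j) = of_real (norm (blinfun_apply f (e j)))))"

(* For a nonzero Banach lattice Z with absolute value ab: the infimum is over a nonempty set of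
   nonnegative reals. *)
definition monotonicity_modulus :: "'z::real_normed_vector set \<Rightarrow> ('z \<Rightarrow> 'z) \<Rightarrow> real \<Rightarrow> real" where
  "monotonicity_modulus Z ab \<epsilon> =
     Inf {norm (ab x + ab y) - 1 | x y. x \<in> Z \<and> y \<in> Z \<and> norm x = 1 \<and> norm y \<ge> \<epsilon>}"

definition uniformly_monotone :: "'z::real_normed_vector set \<Rightarrow> ('z \<Rightarrow> 'z) \<Rightarrow> bool" where
  "uniformly_monotone Z ab \<longleftrightarrow> (\<forall>\<epsilon>>0. monotonicity_modulus Z ab \<epsilon> > 0)"

(* For t \<ge> 0 and M a monotonicity modulus the set contains 0 and, since M \<epsilon> \<ge> \<epsilon> - 1, it is
   bounded above by t + 1. *)
definition modulus_inverse :: "(real \<Rightarrow> real) \<Rightarrow> real \<Rightarrow> real" where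
  "modulus_inverse M t = Sup {\<epsilon>. \<epsilon> \<ge> 0 \<and> M \<epsilon> \<le> t}"

(* Meaningful only if the set is bounded, as it is for maps into a ball. *)
definition modulus_of_continuity ::
    "'z::real_normed_vector set \<Rightarrow> ('z \<Rightarrow> 'z) \<Rightarrow> real \<Rightarrow> real" where
  "modulus_of_continuity Z \<phi> t = Sup {norm (\<phi> x - \<phi> y) | x y. x \<in> Z \<and> y \<in> Z \<and> norm (x - y) \<le> t}"

definition uniformly_simultaneously_continuous_retraction ::
    "('k::real_normed_field \<Rightarrow> 'a::banach \<Rightarrow> 'a) \<Rightarrow> (('a \<Rightarrow>\<^sub>L 'k) \<Rightarrow> ('a \<Rightarrow>\<^sub>L 'k)) \<Rightarrow> bool" where
  "uniformly_simultaneously_continuous_retraction sc \<phi> \<longleftrightarrow>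
     \<phi> \<in> dual_space sc \<rightarrow> dual_ball sc \<and>
     (\<forall>f \<in> dual_ball sc. \<phi> f = f) \<and>
     continuous_map (weak_star_topology sc) (weak_star_topology sc) \<phi> \<and>
     uniformly_continuous_on (dual_space sc) \<phi>"

end

theory Submission
  imports Defs
begin

text \<open>
  The retraction cuts a functional off along the basis. Read \<open>f\<close> coordinate by coordinate and keep
  \<open>f(e\<^sub>0), f(e\<^sub>1), \<dots>\<close> until the norm of what has been kept reaches \<open>1\<close>; the coordinate at which this
  happens is kept in part, and the remaining ones are replaced by \<open>0\<close>. In other words \<open>f\<close> is
  multiplied by a ramp \<open>s\<close> that is \<open>1\<close> at first, descends through at most one intermediate value, and
  then is \<open>0\<close>; functionals in the ball are left as they are. Since the basis constant is \<open>1\<close>, the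
  norm of the dual depends monotonically on the moduli of the coordinates (\<open>dual_norm_mono\<close>), so
  multiplication by a ramp is a contraction.

  The estimate behind everything is \<open>norm_normalized_diff_le\<close>. Any two ramps are comparable. Let \<open>s \<le> s'\<close>
  belong to \<open>f\<close> and \<open>h\<close>, let \<open>\<parallel>f - h\<parallel> \<le> t\<close> and \<open>\<parallel>s f\<parallel> = 1\<close>, and put \<open>w = (s' - s) h\<close>. Then
  \<open>|s f| + |w| \<le> |s (f - h)| + |s h| + |(s' - s) h| = |s (f - h)| + |s' h|\<close> has norm at most \<open>1 + t\<close>,
  hence \<open>M(\<parallel>w\<parallel>) \<le> t\<close> and \<open>\<parallel>w\<parallel> \<le> M\<^sup>-\<^sup>1(t)\<close>. As \<open>s f - s' h = s (f - h) - w\<close>, the two cuts differ by at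
  most \<open>t + M\<^sup>-\<^sup>1(t) \<le> 2 M\<^sup>-\<^sup>1(t)\<close>. Uniform monotonicity makes the left-hand side tend to \<open>0\<close> with \<open>t\<close>.
  With \<open>t = 0\<close> the estimate also shows that the cut of \<open>f\<close> is the same for all admissible ramps, so
  that a ramp may be chosen arbitrarily.

  Weak-* continuity comes at no extra cost. The first \<open>n\<close> coordinates of the cut of \<open>f\<close> are the cut of the
  first \<open>n\<close> coordinates of \<open>f\<close> (\<open>ball_cut_cut_ramp\<close>). Passing to the first \<open>n\<close> coordinates is continuous
  from the weak-* topology to the norm, and the cut is continuous in the norm; so the first \<open>n\<close>
  coordinates of the cut are weak-* continuous. On a given vector the cut is the limit of these as
  \<open>n \<rightarrow> \<infinity>\<close>, uniformly in \<open>f\<close> because the cut takes values in the unit ball.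
\<close>

locale one_unconditional_basis = banach_space_over sc
  for sc :: "'k::real_normed_field \<Rightarrow> 'a::banach \<Rightarrow> 'a" +
  fixes e :: "nat \<Rightarrow> 'a"
  assumes basis: "schauder_basis sc e"
    and norm_e: "norm (e j) = 1"
    and constant_one: "unconditional_basis_constant sc e = 1"
begin

section \<open>Diagonal operators\<close>

lemma norm_sum_unimodular_le:
  assumes "\<And>j. norm (\<theta> j) = 1"
  shows "norm (\<Sum>j<n. sc (\<theta> j * a j) (e j)) \<le> norm (\<Sum>j<n. sc (a j) (e j))"
proof (rule dense_ge)
  \<comment> \<open>The constant only speaks of vectors of norm at most \<open>1\<close>. Dividing by every \<open>r\<close> above the norm,
    rather than by the norm, covers the vector \<open>0\<close> as well.\<close>
  fix r assume r: "norm (\<Sum>j<n. sc (a j) (e j)) < r"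
  then have "0 < r"
    using norm_ge_zero order_le_less_trans by blast
  define c :: 'k where "c = of_real (1 / r)"
  have norm_c: "norm c = 1 / r"
    using \<open>0 < r\<close> by (simp add: c_def norm_divide)
  have scaled: "norm (\<Sum>j<n. sc (c * b j) (e j)) = norm (\<Sum>j<n. sc (b j) (e j)) / r" for b
  proof -
    have "(\<Sum>j<n. sc (c * b j) (e j)) = sc c (\<Sum>j<n. sc (b j) (e j))"
      by (simp add: scale_sum_right)
    then show ?thesis
      by (simp add: norm_sc norm_c)
  qed
  have "norm (\<Sum>j<n. sc (c * a j) (e j)) \<le> 1"
    unfolding scaled using r \<open>0 < r\<close> by simp
  with assms have "ereal (norm (\<Sum>j<n. sc (\<theta> j * (c * a j)) (e j))) \<le> unconditional_basis_constant sc e"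
    unfolding unconditional_basis_constant_def by (intro Sup_upper CollectI exI conjI refl) auto
  then have "norm (\<Sum>j<n. sc (c * (\<theta> j * a j)) (e j)) \<le> 1"
    by (simp add: constant_one mult.left_commute)
  then show "norm (\<Sum>j<n. sc (\<theta> j * a j) (e j)) \<le> r"
    unfolding scaled using \<open>0 < r\<close> by simp
qed

text \<open>A scalar of modulus \<open>r \<le> 1\<close> is the convex combination \<open>(1 + r)/2 \<cdot> u + (1 - r)/2 \<cdot> (-u)\<close> of two
  unimodular ones. This trades the multipliers that are not unimodular for unimodular ones, one
  coordinate at a time; \<open>k\<close> bounds the coordinates that are still to be treated.\<close>

lemma norm_sum_multiplier_le_aux:
  assumes "\<And>j. norm (m j) \<le> 1" and "\<And>j. k \<le> j \<Longrightarrow> norm (m j) = 1"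
  shows "norm (\<Sum>j<n. sc (m j * a j) (e j)) \<le> norm (\<Sum>j<n. sc (a j) (e j))"
  using assms
proof (induction k arbitrary: m)
  case 0
  then show ?case
    by (intro norm_sum_unimodular_le) simp
next
  case (Suc k)
  define u :: 'k where "u = (if m k = 0 then 1 else m k / of_real (norm (m k)))"
  define r where "r = norm (m k)"
  have "0 \<le> r" "r \<le> 1" "norm u = 1" "m k = of_real r * u"
    using Suc.prems(1)[of k] by (auto simp: r_def u_def norm_divide)
  define S where "S q = (\<Sum>j<n. sc (q j * a j) (e j))" for q
  have bound: "norm (S (m(k := v))) \<le> norm (\<Sum>j<n. sc (a j) (e j))" if "norm v = 1" for v
    unfolding S_def using Suc.prems that by (intro Suc.IH) (auto simp: not_less_eq_eq)
  have "m j * a j = of_real ((1 + r) / 2) * ((m(k := u)) j * a j)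
      + of_real ((1 - r) / 2) * ((m(k := - u)) j * a j)" for j
  proof -
    have half: "of_real ((1 + r) / 2) + of_real ((1 - r) / 2) = (1::'k)"
      "of_real ((1 + r) / 2) - of_real ((1 - r) / 2) = (of_real r::'k)"
      unfolding of_real_add[symmetric] of_real_diff[symmetric]
      by (simp_all add: diff_divide_distrib[symmetric] add_divide_distrib[symmetric])
    show ?thesis
    proof (cases "j = k")
      case True
      have "of_real ((1 + r) / 2) * (u * a j) + of_real ((1 - r) / 2) * (- u * a j)
          = (of_real ((1 + r) / 2) - of_real ((1 - r) / 2)) * (u * a j)"
        by (simp only: left_diff_distrib) simp
      then show ?thesis
        using True \<open>m k = of_real r * u\<close> by (simp only: half) simp
    next
      case False
      have "of_real ((1 + r) / 2) * (m j * a j) + of_real ((1 - r) / 2) * (m j * a j)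
          = (of_real ((1 + r) / 2) + of_real ((1 - r) / 2)) * (m j * a j)"
        by (simp only: distrib_right)
      then show ?thesis
        using False by (simp only: half) simp
    qed
  qed
  then have "S m = ((1 + r) / 2) *\<^sub>R S (m(k := u)) + ((1 - r) / 2) *\<^sub>R S (m(k := - u))"
    unfolding S_def scaleR_sum_right sum.distrib[symmetric]
    by (intro sum.cong refl) (metis scale_left_distrib scale_scale sc_of_real)
  then have "norm (S m) \<le> ((1 + r) / 2) * norm (S (m(k := u))) + ((1 - r) / 2) * norm (S (m(k := - u)))"
    using norm_triangle_ineq[of "((1 + r) / 2) *\<^sub>R S (m(k := u))" "((1 - r) / 2) *\<^sub>R S (m(k := - u))"]
      \<open>0 \<le> r\<close> \<open>r \<le> 1\<close> by simp
  also have "\<dots> \<le> ((1 + r) / 2) * norm (\<Sum>j<n. sc (a j) (e j))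
      + ((1 - r) / 2) * norm (\<Sum>j<n. sc (a j) (e j))"
    using \<open>0 \<le> r\<close> \<open>r \<le> 1\<close> \<open>norm u = 1\<close> by (intro add_mono mult_left_mono bound) auto
  also have "\<dots> = norm (\<Sum>j<n. sc (a j) (e j))"
    by (simp add: field_simps)
  finally show ?case
    by (simp add: S_def)
qed

text \<open>Index sets that are not initial segments are needed for the blocks in Cauchy's criterion.\<close>

lemma norm_sum_multiplier_le:
  assumes "finite J" and m: "\<And>j. norm (m j) \<le> 1"
  shows "norm (\<Sum>j\<in>J. sc (m j * a j) (e j)) \<le> norm (\<Sum>j\<in>J. sc (a j) (e j))"
proof -
  obtain n where n: "J \<subseteq> {..<n}"
    using \<open>finite J\<close> finite_nat_iff_bounded by auto
  have extend: "(\<Sum>j\<in>J. sc (q j) (e j)) = (\<Sum>j<n. sc (if j \<in> J then q j else 0) (e j))" for q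
    using n by (intro sum.mono_neutral_cong_left) auto
  let ?m = "\<lambda>j. if j < n then m j else 1"
  have "norm (\<Sum>j<n. sc (?m j * (if j \<in> J then a j else 0)) (e j))
      \<le> norm (\<Sum>j<n. sc (if j \<in> J then a j else 0) (e j))"
    using m by (intro norm_sum_multiplier_le_aux[where k = n]) auto
  also have "(\<Sum>j<n. sc (?m j * (if j \<in> J then a j else 0)) (e j))
      = (\<Sum>j<n. sc (if j \<in> J then m j * a j else 0) (e j))"
    by (intro sum.cong) auto
  finally show ?thesis
    unfolding extend .
qed

definition coord :: "'a \<Rightarrow> nat \<Rightarrow> 'k" where
  "coord x = (THE a. (\<lambda>j. sc (a j) (e j)) sums x)"

lemma coord_sums: "(\<lambda>j. sc (coord x j) (e j)) sums x"
proof -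
  have "\<exists>!a. (\<lambda>j. sc (a j) (e j)) sums x"
    using basis by (simp add: schauder_basis_def)
  then show ?thesis
    unfolding coord_def by (rule theI')
qed

lemma coord_eqI: "(\<lambda>j. sc (a j) (e j)) sums x \<Longrightarrow> coord x = a"
proof -
  assume "(\<lambda>j. sc (a j) (e j)) sums x"
  moreover have "\<exists>!a. (\<lambda>j. sc (a j) (e j)) sums x"
    using basis by (simp add: schauder_basis_def)
  ultimately show "coord x = a"
    using coord_sums[of x] by (elim ex1E) blast
qed

definition diagonal :: "(nat \<Rightarrow> 'k) \<Rightarrow> 'a \<Rightarrow> 'a" where
  "diagonal m x = (\<Sum>j. sc (m j * coord x j) (e j))"

context
  fixes m :: "nat \<Rightarrow> 'k"
  assumes m: "\<forall>j. norm (m j) \<le> 1"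
begin

text \<open>Multiplying the coordinates does not increase the norm of any block of the expansion, so the
  Cauchy criterion passes from the expansion of \<open>x\<close> to the new series.\<close>

lemma diagonal_sums: "(\<lambda>j. sc (m j * coord x j) (e j)) sums diagonal m x"
  unfolding diagonal_def
proof (rule summable_sums)
  have "norm (\<Sum>j\<in>{p..<q}. sc (m j * coord x j) (e j)) \<le> norm (\<Sum>j\<in>{p..<q}. sc (coord x j) (e j))" for p q
    using m by (intro norm_sum_multiplier_le) auto
  moreover have "summable (\<lambda>j. sc (coord x j) (e j))"
    using coord_sums sums_summable by blast
  ultimately show "summable (\<lambda>j. sc (m j * coord x j) (e j))"
    unfolding summable_Cauchy by (meson order_le_less_trans)
qed

lemma coord_diagonal: "coord (diagonal m x) = (\<lambda>j. m j * coord x j)"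
  by (intro coord_eqI diagonal_sums)

lemma norm_diagonal_le: "norm (diagonal m x) \<le> norm x"
proof (rule LIMSEQ_le)
  show "(\<lambda>n. norm (\<Sum>j<n. sc (m j * coord x j) (e j))) \<longlonglongrightarrow> norm (diagonal m x)"
    using diagonal_sums unfolding sums_def by (rule tendsto_norm)
  show "(\<lambda>n. norm (\<Sum>j<n. sc (coord x j) (e j))) \<longlonglongrightarrow> norm x"
    using coord_sums unfolding sums_def by (rule tendsto_norm)
qed (use m in \<open>auto intro!: norm_sum_multiplier_le\<close>)

end

lemma bounded_linear_sc: "bounded_linear (sc c)"
proof (rule bounded_linear_intro)
  show "sc c (r *\<^sub>R x) = r *\<^sub>R sc c x" for r x
    by (simp add: mult.commute flip: sc_of_real)
  show "norm (sc c x) \<le> norm x * norm c" for x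
    by (simp add: norm_sc)
qed (rule scale_right_distrib)

lemma coord_add: "coord (x + y) = (\<lambda>j. coord x j + coord y j)"
  using sums_add[OF coord_sums coord_sums] by (intro coord_eqI) (simp add: scale_left_distrib)

lemma coord_sc: "coord (sc c x) = (\<lambda>j. c * coord x j)"
  using bounded_linear.sums[OF bounded_linear_sc coord_sums] by (intro coord_eqI) simp

lemma coord_e: "coord (e i) = (\<lambda>j. if j = i then 1 else 0)"
proof (rule coord_eqI)
  show "(\<lambda>j. sc (if j = i then 1 else 0) (e j)) sums e i"
    using sums_single[of i "\<lambda>j. e j"] by (rule back_subst[where P = "\<lambda>f. f sums e i"]) auto
qed

definition diagonal_op :: "(nat \<Rightarrow> 'k) \<Rightarrow> 'a \<Rightarrow>\<^sub>L 'a" where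
  "diagonal_op m = Blinfun (diagonal m)"

context
  fixes m :: "nat \<Rightarrow> 'k"
  assumes m: "\<forall>j. norm (m j) \<le> 1"
begin

lemma diagonal_eqI:
  assumes "\<And>j. coord y j = m j * coord x j"
  shows "diagonal m x = y"
proof -
  have "(\<lambda>j. sc (m j * coord x j) (e j)) sums y"
    using coord_sums[of y] by (simp add: assms)
  with diagonal_sums[OF m] show ?thesis
    by (rule sums_unique2)
qed

lemma diagonal_sc: "diagonal m (sc c x) = sc c (diagonal m x)"
  by (rule diagonal_eqI) (simp add: coord_sc coord_diagonal[OF m])

lemma blinfun_apply_diagonal_op: "blinfun_apply (diagonal_op m) = diagonal m"
  unfolding diagonal_op_def
proof (intro bounded_linear_Blinfun_apply bounded_linear_intro)
  show "diagonal m (x + y) = diagonal m x + diagonal m y" for x y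
    by (rule diagonal_eqI) (simp add: coord_add coord_diagonal[OF m] distrib_left)
  show "diagonal m (r *\<^sub>R x) = r *\<^sub>R diagonal m x" for r x
    by (simp add: diagonal_sc flip: sc_of_real)
  show "norm (diagonal m x) \<le> norm x * 1" for x
    using norm_diagonal_le[OF m] by simp
qed

lemma diagonal_e: "diagonal m (e i) = sc (m i) (e i)"
  by (rule diagonal_eqI) (simp add: coord_e coord_sc)

lemma norm_diagonal_op_le: "norm (diagonal_op m) \<le> 1"
  by (rule norm_blinfun_bound) (simp_all add: blinfun_apply_diagonal_op norm_diagonal_le[OF m])

end

section \<open>The dual space as a lattice of coordinate sequences\<close>

lemma dual_space_sc: "f \<in> dual_space sc \<Longrightarrow> blinfun_apply f (sc c x) = c * blinfun_apply f x"
  by (simp add: dual_space_def)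

lemma dual_sums:
  assumes "f \<in> dual_space sc"
  shows "(\<lambda>j. coord x j * blinfun_apply f (e j)) sums blinfun_apply f x"
  using bounded_linear.sums[OF blinfun.bounded_linear_right coord_sums, of f x]
  by (simp add: dual_space_sc[OF assms])

lemma dual_eqI:
  assumes "f \<in> dual_space sc" "g \<in> dual_space sc" "\<And>j. blinfun_apply f (e j) = blinfun_apply g (e j)"
  shows "f = g"
  using dual_sums[OF assms(1)] dual_sums[OF assms(2)] assms(3)
  by (intro blinfun_eqI) (metis (no_types, lifting) sums_cong sums_unique2)

lemma dual_diff: "f \<in> dual_space sc \<Longrightarrow> g \<in> dual_space sc \<Longrightarrow> f - g \<in> dual_space sc"
  by (simp add: dual_space_def blinfun.diff_left right_diff_distrib)

lemma dual_add: "f \<in> dual_space sc \<Longrightarrow> g \<in> dual_space sc \<Longrightarrow> f + g \<in> dual_space sc"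
  by (simp add: dual_space_def blinfun.add_left distrib_left)

lemma dual_scaleR: "f \<in> dual_space sc \<Longrightarrow> r *\<^sub>R f \<in> dual_space sc"
  by (simp add: dual_space_def blinfun.scaleR_left)

context
  fixes m :: "nat \<Rightarrow> 'k"
  assumes m: "\<forall>j. norm (m j) \<le> 1"
begin

lemma dual_diagonal: "f \<in> dual_space sc \<Longrightarrow> f o\<^sub>L diagonal_op m \<in> dual_space sc"
  by (simp add: dual_space_def blinfun_apply_diagonal_op[OF m] diagonal_sc[OF m])

lemma dual_diagonal_e:
  "f \<in> dual_space sc \<Longrightarrow> blinfun_apply (f o\<^sub>L diagonal_op m) (e j) = m j * blinfun_apply f (e j)"
  by (simp add: blinfun_apply_diagonal_op[OF m] diagonal_e[OF m] dual_space_sc)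

lemma norm_dual_diagonal_le: "norm (f o\<^sub>L diagonal_op m) \<le> norm f"
  using norm_blinfun_compose[of f "diagonal_op m"] norm_diagonal_op_le[OF m]
    mult_left_mono[OF norm_diagonal_op_le[OF m], of "norm f"] by simp

end

text \<open>The quotients of the coordinates of \<open>f\<close> by those of \<open>g\<close> have modulus at most \<open>1\<close>, so \<open>f\<close> is the
  composition of \<open>g\<close> with a contractive diagonal operator.\<close>

lemma dual_norm_mono:
  assumes f: "f \<in> dual_space sc" and g: "g \<in> dual_space sc"
    and le: "\<And>j. norm (blinfun_apply f (e j)) \<le> norm (blinfun_apply g (e j))"
  shows "norm f \<le> norm g"
proof -
  define m where "m j = blinfun_apply f (e j) / blinfun_apply g (e j)" for j
  \<comment> \<open>Where \<open>g\<close> vanishes so does \<open>f\<close>, and the quotient \<open>0 / 0 = 0\<close> is a correct multiplier.\<close>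
  have m: "\<forall>j. norm (m j) \<le> 1"
    using le by (auto simp: m_def norm_divide divide_le_eq_1)
  have "f = g o\<^sub>L diagonal_op m"
  proof (intro dual_eqI f dual_diagonal g)
    show "blinfun_apply f (e j) = blinfun_apply (g o\<^sub>L diagonal_op m) (e j)" for j
      using le[of j] by (subst dual_diagonal_e[OF m g]) (auto simp: m_def)
  qed (rule m)
  then show ?thesis
    using norm_dual_diagonal_le[OF m] by metis
qed

text \<open>The definite description denotes something because \<open>|f|\<close> is \<open>f\<close> composed with the diagonal operator
  that turns each coordinate to the positive real axis.\<close>

lemma dual_abs_in_dual: "f \<in> dual_space sc \<Longrightarrow> dual_abs sc e f \<in> dual_space sc"
  and dual_abs_e:
    "f \<in> dual_space sc \<Longrightarrow> blinfun_apply (dual_abs sc e f) (e j) = of_real (norm (blinfun_apply f (e j)))"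
proof -
  assume f: "f \<in> dual_space sc"
  define m :: "nat \<Rightarrow> 'k" where
    "m j = of_real (norm (blinfun_apply f (e j))) / blinfun_apply f (e j)" for j
  have m: "\<forall>j. norm (m j) \<le> 1"
    by (auto simp: m_def norm_divide)
  let ?P = "\<lambda>g. g \<in> dual_space sc \<and> (\<forall>j. blinfun_apply g (e j) = of_real (norm (blinfun_apply f (e j))))"
  have "m j * blinfun_apply f (e j) = of_real (norm (blinfun_apply f (e j)))" for j
    by (simp add: m_def)
  then have P: "?P (f o\<^sub>L diagonal_op m)"
    using dual_diagonal[OF m f] dual_diagonal_e[OF m f]
    by (simp del: blinfun_apply_blinfun_compose)
  moreover have "g = f o\<^sub>L diagonal_op m" if "?P g" for g
    using that P by (intro dual_eqI) (auto simp del: blinfun_apply_blinfun_compose)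
  ultimately have "?P (dual_abs sc e f)"
    unfolding dual_abs_def by (rule theI)
  then show "dual_abs sc e f \<in> dual_space sc"
    and "blinfun_apply (dual_abs sc e f) (e j) = of_real (norm (blinfun_apply f (e j)))" for j
    by auto
qed

lemma coordinate_functional:
  obtains f where "f \<in> dual_space sc" "\<And>x. blinfun_apply f x = coord x i" "norm f = 1"
proof -
  have bound: "norm (coord x i) \<le> norm x" for x
  proof -
    define m :: "nat \<Rightarrow> 'k" where "m j = (if j = i then 1 else 0)" for j
    have m: "\<forall>j. norm (m j) \<le> 1"
      by (simp add: m_def)
    have "diagonal m x = sc (coord x i) (e i)"
      by (rule diagonal_eqI[OF m]) (simp add: coord_sc coord_e m_def)
    then show ?thesis
      using norm_diagonal_le[OF m, of x] by (simp add: norm_sc norm_e)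
  qed
  have bl: "bounded_linear (\<lambda>x. coord x i)"
  proof (rule bounded_linear_intro)
    show "coord (r *\<^sub>R x) i = r *\<^sub>R coord x i" for r x
      using fun_cong[OF coord_sc[of "of_real r" x], of i] by (simp add: sc_of_real scaleR_conv_of_real)
    show "norm (coord x i) \<le> norm x * 1" for x
      using bound by simp
  qed (simp add: coord_add)
  define f where "f = Blinfun (\<lambda>x. coord x i)"
  have f: "blinfun_apply f x = coord x i" for x
    using bl by (simp add: f_def bounded_linear_Blinfun_apply)
  have "norm f = 1"
  proof (rule antisym)
    show "norm f \<le> 1"
      using bound by (intro norm_blinfun_bound) (auto simp: f)
    show "1 \<le> norm f"
      using norm_blinfun[of f "e i"] by (simp add: f coord_e norm_e)
  qed
  with f show ?thesis
    by (intro that[of f]) (auto simp: dual_space_def coord_sc)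
qed

section \<open>The modulus of monotonicity and its inverse\<close>

lemma dual_abs_add_e:
  assumes "f \<in> dual_space sc" "g \<in> dual_space sc"
  shows "blinfun_apply (dual_abs sc e f + dual_abs sc e g) (e j)
    = of_real (norm (blinfun_apply f (e j)) + norm (blinfun_apply g (e j)))"
  using assms by (simp add: blinfun.add_left dual_abs_e)

lemma norm_dual_abs_add_e:
  assumes "f \<in> dual_space sc" "g \<in> dual_space sc"
  shows "norm (blinfun_apply (dual_abs sc e f + dual_abs sc e g) (e j))
    = norm (blinfun_apply f (e j)) + norm (blinfun_apply g (e j))"
  unfolding dual_abs_add_e[OF assms] norm_of_real by simp

lemma dual_abs_add_in_dual:
  "f \<in> dual_space sc \<Longrightarrow> g \<in> dual_space sc \<Longrightarrow> dual_abs sc e f + dual_abs sc e g \<in> dual_space sc"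
  by (intro dual_add dual_abs_in_dual)

lemma norm_le_dual_abs_add:
  assumes "f \<in> dual_space sc" "g \<in> dual_space sc"
  shows "norm f \<le> norm (dual_abs sc e f + dual_abs sc e g)"
    and "norm g \<le> norm (dual_abs sc e f + dual_abs sc e g)"
  using assms by (auto intro!: dual_norm_mono dual_abs_add_in_dual simp: norm_dual_abs_add_e)

lemma norm_dual_abs: "f \<in> dual_space sc \<Longrightarrow> norm (dual_abs sc e f) = norm f"
  by (intro antisym dual_norm_mono) (simp_all add: dual_abs_in_dual dual_abs_e)

abbreviation (input) modulus :: "real \<Rightarrow> real" where
  "modulus \<equiv> monotonicity_modulus (dual_space sc) (dual_abs sc e)"

lemma modulus_le:
  assumes "f \<in> dual_space sc" "g \<in> dual_space sc" "norm f = 1" "\<epsilon> \<le> norm g"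
  shows "modulus \<epsilon> \<le> norm (dual_abs sc e f + dual_abs sc e g) - 1"
  unfolding monotonicity_modulus_def
proof (rule cInf_lower)
  show "bdd_below {norm (dual_abs sc e x + dual_abs sc e y) - 1 | x y.
      x \<in> dual_space sc \<and> y \<in> dual_space sc \<and> norm x = 1 \<and> \<epsilon> \<le> norm y}"
  proof (rule bdd_belowI, safe)
    show "0 \<le> norm (dual_abs sc e x + dual_abs sc e y) - 1"
      if "x \<in> dual_space sc" "y \<in> dual_space sc" "norm x = 1" for x y
      using norm_le_dual_abs_add(1)[OF that(1,2)] that(3) by simp
  qed
qed (use assms in blast)

text \<open>The bound passes to the infimum because the set is nonempty for every \<open>\<epsilon>\<close>: the dual contains a
  coordinate functional, hence vectors of every norm.\<close>

lemma modulus_greatest: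
  assumes "\<And>f g. f \<in> dual_space sc \<Longrightarrow> g \<in> dual_space sc \<Longrightarrow> norm f = 1 \<Longrightarrow> \<epsilon> \<le> norm g \<Longrightarrow>
    c \<le> norm (dual_abs sc e f + dual_abs sc e g) - 1"
  shows "c \<le> modulus \<epsilon>"
  unfolding monotonicity_modulus_def
proof (rule cInf_greatest)
  obtain f where f: "f \<in> dual_space sc" "norm f = 1"
    using coordinate_functional by blast
  then have "\<bar>\<epsilon>\<bar> *\<^sub>R f \<in> dual_space sc" "\<epsilon> \<le> norm (\<bar>\<epsilon>\<bar> *\<^sub>R f)"
    by (simp_all add: dual_scaleR)
  with f show "{norm (dual_abs sc e x + dual_abs sc e y) - 1 | x y.
      x \<in> dual_space sc \<and> y \<in> dual_space sc \<and> norm x = 1 \<and> \<epsilon> \<le> norm y} \<noteq> {}"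
    by blast
qed (use assms in blast)

lemma modulus_mono: "\<epsilon> \<le> \<epsilon>' \<Longrightarrow> modulus \<epsilon> \<le> modulus \<epsilon>'"
  by (rule modulus_greatest) (rule modulus_le, auto)

lemma modulus_ge: "\<epsilon> - 1 \<le> modulus \<epsilon>"
proof (rule modulus_greatest)
  show "\<epsilon> - 1 \<le> norm (dual_abs sc e f + dual_abs sc e g) - 1"
    if "f \<in> dual_space sc" "g \<in> dual_space sc" "\<epsilon> \<le> norm g" for f g
    using norm_le_dual_abs_add(2)[OF that(1,2)] that(3) by simp
qed

text \<open>Take \<open>x\<close> of norm \<open>1\<close> and \<open>y = \<epsilon> x\<close>. This bound gives \<open>t \<le> M\<^sup>-\<^sup>1(t)\<close>, which turns
  \<open>t + M\<^sup>-\<^sup>1(t)\<close> into \<open>2 M\<^sup>-\<^sup>1(t)\<close>.\<close>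

lemma modulus_le_self:
  assumes "0 \<le> \<epsilon>"
  shows "modulus \<epsilon> \<le> \<epsilon>"
proof -
  obtain f where f: "f \<in> dual_space sc" "norm f = 1"
    using coordinate_functional by blast
  then have "modulus \<epsilon> \<le> norm (dual_abs sc e f + dual_abs sc e (\<epsilon> *\<^sub>R f)) - 1"
    using assms by (intro modulus_le) (auto simp: dual_scaleR)
  also have "\<dots> \<le> (norm (dual_abs sc e f) + norm (dual_abs sc e (\<epsilon> *\<^sub>R f))) - 1"
    by (intro diff_right_mono norm_triangle_ineq)
  also have "\<dots> = \<epsilon>"
    using f assms by (simp add: norm_dual_abs dual_scaleR)
  finally show ?thesis .
qed

lemma le_modulus_inverse:
  assumes "0 \<le> \<epsilon>" "modulus \<epsilon> \<le> t"
  shows "\<epsilon> \<le> modulus_inverse modulus t"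
  unfolding modulus_inverse_def
proof (rule cSup_upper)
  show "bdd_above {\<epsilon>. 0 \<le> \<epsilon> \<and> modulus \<epsilon> \<le> t}"
  proof (rule bdd_aboveI)
    show "x \<le> t + 1" if "x \<in> {\<epsilon>. 0 \<le> \<epsilon> \<and> modulus \<epsilon> \<le> t}" for x
      using that modulus_ge[of x] by auto
  qed
qed (use assms in simp)

lemma self_le_modulus_inverse: "0 \<le> t \<Longrightarrow> t \<le> modulus_inverse modulus t"
  by (intro le_modulus_inverse modulus_le_self)

lemma modulus_inverse_le:
  assumes "0 \<le> t" "t < modulus \<epsilon>"
  shows "modulus_inverse modulus t \<le> \<epsilon>"
  unfolding modulus_inverse_def
proof (rule cSup_least)
  show "{\<epsilon>. 0 \<le> \<epsilon> \<and> modulus \<epsilon> \<le> t} \<noteq> {}"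
    using order_trans[OF modulus_le_self[of 0] \<open>0 \<le> t\<close>] by (intro ex_in_conv[THEN iffD1] exI[of _ 0]) simp
  show "x \<le> \<epsilon>" if "x \<in> {\<epsilon>. 0 \<le> \<epsilon> \<and> modulus \<epsilon> \<le> t}" for x
    using that modulus_mono[of \<epsilon> x] \<open>t < modulus \<epsilon>\<close> by (cases "x \<le> \<epsilon>") auto
qed

section \<open>Cutting off the tail of a functional\<close>

text \<open>For growing \<open>\<tau>\<close> the ramps run continuously through the multipliers \<open>(1, \<dots>, 1, \<theta>, 0, 0, \<dots>)\<close> with
  \<open>0 \<le> \<theta> \<le> 1\<close>. At \<open>\<tau> = n\<close> exactly the coordinates \<open>0, \<dots>, n - 1\<close> are kept, so cutting with
  \<open>ramp n\<close> is the adjoint of the \<open>n\<close>-th partial sum projection.\<close>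

definition ramp :: "real \<Rightarrow> nat \<Rightarrow> real" where
  "ramp \<tau> j = max 0 (min 1 (\<tau> - real j))"

text \<open>The constant \<open>1\<close> is the ramp of infinite length.\<close>

definition cutoff :: "(nat \<Rightarrow> real) \<Rightarrow> bool" where
  "cutoff s \<longleftrightarrow> s = (\<lambda>_. 1) \<or> (\<exists>\<tau>\<ge>0. s = ramp \<tau>)"

definition cut :: "(nat \<Rightarrow> real) \<Rightarrow> ('a \<Rightarrow>\<^sub>L 'k) \<Rightarrow> ('a \<Rightarrow>\<^sub>L 'k)" where
  "cut s f = f o\<^sub>L diagonal_op (\<lambda>j. of_real (s j))"

lemma ramp_of_nat: "ramp (real n) j = (if j < n then 1 else 0)"
  by (auto simp: ramp_def)

lemma cutoff_one: "cutoff (\<lambda>_. 1)"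
  by (simp add: cutoff_def)

lemma cutoff_ramp: "0 \<le> \<tau> \<Longrightarrow> cutoff (ramp \<tau>)"
  by (auto simp: cutoff_def)

lemma cutoff_nonneg: "cutoff s \<Longrightarrow> 0 \<le> s j"
  and cutoff_le_one: "cutoff s \<Longrightarrow> s j \<le> 1"
  by (auto simp: cutoff_def ramp_def)

lemma cutoff_linear:
  assumes "cutoff s" "cutoff s'"
  shows "(\<forall>j. s j \<le> s' j) \<or> (\<forall>j. s' j \<le> s j)"
proof -
  have "(\<forall>j. ramp \<tau> j \<le> ramp \<sigma> j) \<or> (\<forall>j. ramp \<sigma> j \<le> ramp \<tau> j)" for \<tau> \<sigma>
    by (cases "\<tau> \<le> \<sigma>") (auto simp: ramp_def)
  then show ?thesis
    using assms cutoff_le_one[OF assms(1)] cutoff_le_one[OF assms(2)] unfolding cutoff_def by (elim disjE) auto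
qed

context
  fixes s :: "nat \<Rightarrow> real"
  assumes s: "cutoff s"
begin

lemma cutoff_contractive: "\<forall>j. norm (of_real (s j) :: 'k) \<le> 1"
  using cutoff_nonneg[OF s] cutoff_le_one[OF s] by simp

lemma cut_in_dual: "f \<in> dual_space sc \<Longrightarrow> cut s f \<in> dual_space sc"
  unfolding cut_def by (rule dual_diagonal[OF cutoff_contractive])

lemma cut_e: "f \<in> dual_space sc \<Longrightarrow> blinfun_apply (cut s f) (e j) = of_real (s j) * blinfun_apply f (e j)"
  unfolding cut_def by (rule dual_diagonal_e[OF cutoff_contractive])

lemma norm_cut_le: "norm (cut s f) \<le> norm f"
  unfolding cut_def by (rule norm_dual_diagonal_le[OF cutoff_contractive])

end

lemma cut_commute:
  assumes "cutoff s" "cutoff s'" "f \<in> dual_space sc"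
  shows "cut s (cut s' f) = cut s' (cut s f)"
  using assms by (intro dual_eqI) (simp_all add: cut_in_dual cut_e)

lemma cut_one: "f \<in> dual_space sc \<Longrightarrow> cut (\<lambda>_. 1) f = f"
  by (intro dual_eqI) (simp_all add: cut_in_dual cut_e cutoff_one)

lemma cut_ramp_apply:
  assumes f: "f \<in> dual_space sc"
  shows "blinfun_apply (cut (ramp (real n)) f) x = (\<Sum>j<n. coord x j * blinfun_apply f (e j))"
proof -
  have p: "cutoff (ramp (real n))"
    by (simp add: cutoff_ramp)
  have "(\<lambda>j. coord x j * (of_real (ramp (real n) j) * blinfun_apply f (e j))) sums
      blinfun_apply (cut (ramp (real n)) f) x"
    using dual_sums[OF cut_in_dual[OF p f], of x] by (simp add: cut_e[OF p f])
  moreover have "(\<lambda>j. coord x j * (of_real (ramp (real n) j) * blinfun_apply f (e j))) sums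
      (\<Sum>j<n. coord x j * (of_real (ramp (real n) j) * blinfun_apply f (e j)))"
    by (rule sums_finite) (auto simp: ramp_of_nat)
  ultimately show ?thesis
    by (auto dest: sums_unique2 simp: ramp_of_nat)
qed

text \<open>The ramp is \<open>1\<close>-Lipschitz in its length, simultaneously at all coordinates.\<close>

lemma norm_cut_ramp_diff_le:
  assumes f: "f \<in> dual_space sc" and nonneg: "0 \<le> \<tau>" "0 \<le> \<sigma>"
  shows "norm (cut (ramp \<tau>) f - cut (ramp \<sigma>) f) \<le> \<bar>\<tau> - \<sigma>\<bar> * norm f"
proof -
  have cutoffs: "cutoff (ramp \<tau>)" "cutoff (ramp \<sigma>)"
    using nonneg by (auto intro: cutoff_ramp)
  have "norm (cut (ramp \<tau>) f - cut (ramp \<sigma>) f) \<le> norm (\<bar>\<tau> - \<sigma>\<bar> *\<^sub>R f)"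
  proof (intro dual_norm_mono dual_diff cut_in_dual dual_scaleR cutoffs f)
    fix j
    have "blinfun_apply (cut (ramp \<tau>) f - cut (ramp \<sigma>) f) (e j)
        = of_real (ramp \<tau> j - ramp \<sigma> j) * blinfun_apply f (e j)"
      using cutoffs f by (simp add: blinfun.diff_left cut_e left_diff_distrib)
    moreover have "\<bar>ramp \<tau> j - ramp \<sigma> j\<bar> \<le> \<bar>\<tau> - \<sigma>\<bar>"
      by (auto simp: ramp_def max_def min_def)
    ultimately show "norm (blinfun_apply (cut (ramp \<tau>) f - cut (ramp \<sigma>) f) (e j))
        \<le> norm (blinfun_apply (\<bar>\<tau> - \<sigma>\<bar> *\<^sub>R f) (e j))"
      by (simp add: norm_mult blinfun.scaleR_left mult_right_mono del: of_real_diff)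
  qed
  then show ?thesis
    by simp
qed

lemma topspace_weak_star: "topspace (weak_star_topology sc) = dual_space sc"
  by (simp add: weak_star_topology_def strong_operator_topology_topspace)

lemma continuous_map_weak_star_eval:
  "continuous_map (weak_star_topology sc) euclidean (\<lambda>f. blinfun_apply f x)"
  unfolding weak_star_topology_def
  by (intro continuous_map_from_subtopology strong_operator_topology_continuous_evaluation)

text \<open>Keeping only \<open>n\<close> coordinates produces a finite sum of coordinate functionals with coefficients
  \<open>f (e j)\<close>, which are weak-* continuous in \<open>f\<close>; hence the result varies continuously in norm.\<close>

lemma continuous_map_weak_star_cut_ramp:
  "continuous_map (weak_star_topology sc) euclidean (cut (ramp (real n)))"
proof -
  have "\<exists>E. \<forall>x. blinfun_apply E x = coord x i" for i
    using coordinate_functional[of i] by blast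
  then obtain E where E: "\<And>i x. blinfun_apply (E i) x = coord x i"
    by metis
  have "continuous_map (weak_star_topology sc) euclidean
      (\<lambda>f. \<Sum>j<n. blinfun_mult_right (blinfun_apply f (e j)) o\<^sub>L E j)"
  proof (intro continuous_map_sum)
    fix j
    have "continuous_on UNIV (\<lambda>c. blinfun_mult_right c o\<^sub>L E j)"
      by (intro continuous_intros bounded_linear.continuous_on[OF bounded_linear_blinfun_mult_right])
    then have "continuous_map euclidean euclidean (\<lambda>c. blinfun_mult_right c o\<^sub>L E j)"
      by simp
    from continuous_map_compose[OF continuous_map_weak_star_eval[of "e j"] this]
    show "continuous_map (weak_star_topology sc) euclidean
        (\<lambda>f. blinfun_mult_right (blinfun_apply f (e j)) o\<^sub>L E j)"
      by (simp add: o_def)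
  qed simp
  then show ?thesis
  proof (rule continuous_map_eq)
    fix f assume "f \<in> topspace (weak_star_topology sc)"
    then have "f \<in> dual_space sc"
      by (simp add: topspace_weak_star)
    then show "(\<Sum>j<n. blinfun_mult_right (blinfun_apply f (e j)) o\<^sub>L E j) = cut (ramp (real n)) f"
      by (intro blinfun_eqI) (simp add: cut_ramp_apply blinfun.sum_left E mult.commute)
  qed
qed

section \<open>The retraction\<close>

text \<open>A multiplier is admissible if it cuts \<open>f\<close> to norm \<open>1\<close>, or does not change \<open>f\<close> because \<open>f\<close> lies in
  the ball already.\<close>

definition normalizing :: "('a \<Rightarrow>\<^sub>L 'k) \<Rightarrow> (nat \<Rightarrow> real) \<Rightarrow> bool" where
  "normalizing f s \<longleftrightarrow> cutoff s \<and> norm (cut s f) \<le> 1 \<and> (cut s f = f \<or> norm (cut s f) = 1)"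

lemma normalizing_one: "f \<in> dual_ball sc \<Longrightarrow> normalizing f (\<lambda>_. 1)"
  by (simp add: normalizing_def dual_ball_def cutoff_one cut_one)

text \<open>The norm of the part that is kept starts at \<open>0\<close>, depends continuously on the length of the ramp and
  exceeds \<open>1\<close> eventually if \<open>\<parallel>f\<parallel> > 1\<close>, because the initial parts of \<open>f\<close> converge to \<open>f\<close> pointwise.\<close>

lemma normalizing_exists:
  assumes f: "f \<in> dual_space sc"
  obtains s where "normalizing f s"
proof (cases "norm f \<le> 1")
  case True
  then show ?thesis
    using f that[OF normalizing_one] by (simp add: dual_ball_def)
next
  case False
  have "\<exists>n. 1 < norm (cut (ramp (real n)) f)"
  proof (rule ccontr)
    assume "\<nexists>n. 1 < norm (cut (ramp (real n)) f)"
    then have small: "norm (cut (ramp (real n)) f) \<le> 1" for n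
      by (simp add: not_less)
    have "norm (blinfun_apply f x) \<le> norm x" for x
    proof (rule LIMSEQ_le_const2)
      show "(\<lambda>n. norm (blinfun_apply (cut (ramp (real n)) f) x)) \<longlonglongrightarrow> norm (blinfun_apply f x)"
        unfolding cut_ramp_apply[OF f] using dual_sums[OF f] unfolding sums_def
        by (rule tendsto_norm)
      have "norm (blinfun_apply (cut (ramp (real n)) f) x) \<le> 1 * norm x" for n
        using norm_blinfun mult_right_mono[OF small norm_ge_zero] by (rule order_trans)
      then show "\<exists>N. \<forall>n\<ge>N. norm (blinfun_apply (cut (ramp (real n)) f) x) \<le> norm x"
        by simp
    qed
    then have "norm f \<le> 1"
      by (intro norm_blinfun_bound) auto
    with False show False
      by simp
  qed
  then obtain n where n: "1 < norm (cut (ramp (real n)) f)"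
    by blast
  have "blinfun_apply (cut (ramp (real 0)) f) x = 0" for x
    unfolding cut_ramp_apply[OF f] by simp
  then have start: "cut (ramp 0) f = 0"
    by (intro blinfun_eqI) simp
  have "(norm f)-lipschitz_on {0..real n} (\<lambda>\<tau>. cut (ramp \<tau>) f)"
    using norm_cut_ramp_diff_le[OF f] by (intro lipschitz_onI) (auto simp: dist_norm mult.commute)
  then have "continuous_on {0..real n} (\<lambda>\<tau>. norm (cut (ramp \<tau>) f))"
    by (intro continuous_on_norm lipschitz_on_continuous_on)
  then obtain \<tau> where "0 \<le> \<tau>" "norm (cut (ramp \<tau>) f) = 1"
    using IVT'[of "\<lambda>\<tau>. norm (cut (ramp \<tau>) f)" 0 1 "real n"] n start by auto
  then show ?thesis
    by (intro that[of "ramp \<tau>"]) (simp add: normalizing_def cutoff_ramp)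
qed

text \<open>If \<open>s\<close> leaves \<open>f\<close> unchanged, then so does the larger \<open>s'\<close>, and the distance is
  \<open>\<parallel>s' (f - h)\<parallel> \<le> t\<close>. Otherwise \<open>s f\<close> has norm \<open>1\<close>, and monotonicity bounds the part \<open>w\<close> of \<open>h\<close>
  that lies between the two cuts.\<close>

lemma norm_normalized_diff_le_aux:
  assumes f: "f \<in> dual_space sc" and h: "h \<in> dual_space sc"
    and s: "normalizing f s" and s': "normalizing h s'" and le: "\<And>j. s j \<le> s' j"
    and t: "norm (f - h) \<le> t"
  shows "norm (cut s f - cut s' h) \<le> t + modulus_inverse modulus t"
proof -
  have cutoffs: "cutoff s" "cutoff s'"
    using s s' by (auto simp: normalizing_def)
  note range = cutoff_nonneg[OF cutoffs(1)] cutoff_nonneg[OF cutoffs(2)]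
    cutoff_le_one[OF cutoffs(1)] cutoff_le_one[OF cutoffs(2)]
  note in_dual = f h dual_diff dual_add cut_in_dual cutoffs
  note coords = blinfun.diff_left blinfun.add_left cut_e[OF cutoffs(1)] cut_e[OF cutoffs(2)] f h dual_diff
  have "0 \<le> t"
    using t norm_ge_zero order_trans by blast
  consider "cut s f = f" | "norm (cut s f) = 1"
    using s by (auto simp: normalizing_def)
  then show ?thesis
  proof cases
    case 1
    have "norm (cut s f - cut s' h) \<le> norm (f - h)"
    proof (intro dual_norm_mono in_dual)
      fix j
      have "of_real (s j) * blinfun_apply f (e j) = blinfun_apply f (e j)"
        using cut_e[OF cutoffs(1) f, of j] 1 by simp
      then have "blinfun_apply f (e j) = 0 \<or> s' j = 1"
        using le[of j] range(4)[of j] by auto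
      then show "norm (blinfun_apply (cut s f - cut s' h) (e j)) \<le> norm (blinfun_apply (f - h) (e j))"
        using 1 range(2,4)[of j] by (auto simp: coords norm_mult mult_left_le_one_le)
    qed
    then show ?thesis
      using t self_le_modulus_inverse[OF \<open>0 \<le> t\<close>] \<open>0 \<le> t\<close> by linarith
  next
    case 2
    define w where "w = cut s' h - cut s h"
    have w: "w \<in> dual_space sc"
      unfolding w_def by (intro in_dual)
    have "norm (dual_abs sc e (cut s f) + dual_abs sc e w)
        \<le> norm (dual_abs sc e (cut s' h) + dual_abs sc e (cut s (f - h)))"
    proof (intro dual_norm_mono dual_abs_add_in_dual in_dual w)
      fix j
      let ?f = "blinfun_apply f (e j)" and ?h = "blinfun_apply h (e j)"
      have "norm (blinfun_apply w (e j)) = (s' j - s j) * norm ?h"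
      proof -
        have "blinfun_apply w (e j) = of_real (s' j - s j) * ?h"
          by (simp add: w_def coords left_diff_distrib)
        then show ?thesis
          using le[of j] by (simp add: norm_mult del: of_real_diff)
      qed
      moreover have "s j * norm ?f \<le> s j * norm ?h + s j * norm (?f - ?h)"
        using mult_left_mono[OF norm_triangle_sub[of ?f ?h] range(1)[of j]] by (simp add: distrib_left)
      moreover have "norm (blinfun_apply (cut s (f - h)) (e j)) = s j * norm (?f - ?h)"
        using cut_e[OF cutoffs(1) dual_diff[OF f h], of j] range(1)[of j]
        by (simp add: norm_mult blinfun.diff_left)
      moreover have "norm (blinfun_apply (cut s f) (e j)) = s j * norm ?f"
        "norm (blinfun_apply (cut s' h) (e j)) = s' j * norm ?h"
        using range(1,2)[of j] by (simp_all add: coords norm_mult)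
      ultimately show "norm (blinfun_apply (dual_abs sc e (cut s f) + dual_abs sc e w) (e j))
          \<le> norm (blinfun_apply (dual_abs sc e (cut s' h) + dual_abs sc e (cut s (f - h))) (e j))"
        by (subst (1 2) norm_dual_abs_add_e) (auto intro: in_dual w simp: left_diff_distrib)
    qed
    also have "\<dots> \<le> norm (dual_abs sc e (cut s' h)) + norm (dual_abs sc e (cut s (f - h)))"
      by (rule norm_triangle_ineq)
    also have "\<dots> = norm (cut s' h) + norm (cut s (f - h))"
      by (simp add: norm_dual_abs in_dual)
    also have "\<dots> \<le> 1 + t"
      using s' t norm_cut_le[OF cutoffs(1), of "f - h"] by (intro add_mono) (auto simp: normalizing_def)
    finally have "modulus (norm w) \<le> t"
      using modulus_le[OF cut_in_dual[OF cutoffs(1) f] w 2, of "norm w"] by simp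
    then have "norm w \<le> modulus_inverse modulus t"
      by (intro le_modulus_inverse) auto
    moreover have "cut s f - cut s' h = cut s (f - h) - w"
      unfolding w_def
      by (intro dual_eqI in_dual) (simp add: coords cut_e[OF cutoffs(1) dual_diff[OF f h]] right_diff_distrib)
    moreover have "norm (cut s (f - h)) \<le> t"
      using norm_cut_le[OF cutoffs(1)] t by (rule order_trans)
    ultimately show ?thesis
      using norm_triangle_ineq4[of "cut s (f - h)" w] by simp
  qed
qed

lemma norm_normalized_diff_le:
  assumes "f \<in> dual_space sc" "h \<in> dual_space sc" "normalizing f s" "normalizing h s'"
    "norm (f - h) \<le> t"
  shows "norm (cut s f - cut s' h) \<le> t + modulus_inverse modulus t"
proof -
  have "(\<forall>j. s j \<le> s' j) \<or> (\<forall>j. s' j \<le> s j)"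
    using assms by (intro cutoff_linear) (auto simp: normalizing_def)
  then show ?thesis
    using norm_normalized_diff_le_aux[of f h s s' t] norm_normalized_diff_le_aux[of h f s' s t] assms
    by (auto simp: norm_minus_commute)
qed

text \<open>All admissible multipliers give the same cut when the dual is uniformly monotone
  (\<open>ball_cut_eqI\<close>), so the choice does not matter.\<close>

definition ball_cut :: "('a \<Rightarrow>\<^sub>L 'k) \<Rightarrow> ('a \<Rightarrow>\<^sub>L 'k)" where
  "ball_cut f = cut (SOME s. normalizing f s) f"

lemma ball_cut_some:
  assumes "f \<in> dual_space sc"
  obtains s where "normalizing f s" "ball_cut f = cut s f"
proof -
  have "\<exists>s. normalizing f s"
    using normalizing_exists[OF assms] by blast
  then have "normalizing f (SOME s. normalizing f s)"
    by (rule someI_ex)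
  then show ?thesis
    by (rule that) (rule ball_cut_def)
qed

lemma ball_cut_in_ball:
  assumes f: "f \<in> dual_space sc"
  shows "ball_cut f \<in> dual_ball sc"
proof -
  obtain s where "normalizing f s" "ball_cut f = cut s f"
    using ball_cut_some[OF f] by blast
  then show ?thesis
    using cut_in_dual[of s f] f by (simp add: dual_ball_def normalizing_def)
qed

lemma norm_ball_cut_diff_le:
  assumes "f \<in> dual_space sc" "h \<in> dual_space sc" "norm (f - h) \<le> t"
  shows "norm (ball_cut f - ball_cut h) \<le> t + modulus_inverse modulus t"
proof -
  obtain s s' where "normalizing f s" "ball_cut f = cut s f" "normalizing h s'" "ball_cut h = cut s' h"
    using ball_cut_some[OF assms(1)] ball_cut_some[OF assms(2)] by metis
  with norm_normalized_diff_le[OF assms(1,2) _ _ assms(3)] show ?thesis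
    by simp
qed

context
  assumes monotone: "uniformly_monotone (dual_space sc) (dual_abs sc e)"
begin

lemma modulus_pos: "0 < \<epsilon> \<Longrightarrow> 0 < modulus \<epsilon>"
  using monotone by (simp add: uniformly_monotone_def)

lemma modulus_inverse_zero: "modulus_inverse modulus 0 = 0"
proof (rule antisym)
  show "modulus_inverse modulus 0 \<le> 0"
    by (rule field_le_epsilon) (use modulus_inverse_le[OF order_refl modulus_pos] in simp)
qed (rule self_le_modulus_inverse, simp)

text \<open>Two admissible multipliers for the same \<open>f\<close> are compared by the estimate with \<open>t = 0\<close>, where
  \<open>M\<^sup>-\<^sup>1(0) = 0\<close>.\<close>

lemma ball_cut_eqI:
  assumes "f \<in> dual_space sc" "normalizing f s"
  shows "ball_cut f = cut s f"
proof -
  obtain s' where "normalizing f s'" "ball_cut f = cut s' f"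
    using assms ball_cut_some by blast
  then show ?thesis
    using norm_normalized_diff_le[OF assms(1) assms(1), of s' s 0] assms(2)
    by (simp add: modulus_inverse_zero)
qed

lemma ball_cut_ball: "f \<in> dual_ball sc \<Longrightarrow> ball_cut f = f"
  using ball_cut_eqI[OF _ normalizing_one] cut_one by (simp add: dual_ball_def)

lemma ball_cut_uniformly_continuous: "uniformly_continuous_on (dual_space sc) ball_cut"
  unfolding uniformly_continuous_on_def
proof (intro allI impI)
  fix \<epsilon> :: real assume "0 < \<epsilon>"
  define d where "d = min (\<epsilon> / 3) (modulus (\<epsilon> / 3))"
  have "0 < d"
    using \<open>0 < \<epsilon>\<close> modulus_pos[of "\<epsilon> / 3"] by (simp add: d_def)
  moreover have "dist (ball_cut h) (ball_cut f) < \<epsilon>"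
    if "f \<in> dual_space sc" "h \<in> dual_space sc" "dist h f < d" for f h
  proof -
    have "norm (h - f) < \<epsilon> / 3" "norm (h - f) < modulus (\<epsilon> / 3)"
      using that(3) by (simp_all add: d_def dist_norm)
    then show ?thesis
      using norm_ball_cut_diff_le[OF that(2,1) order_refl] modulus_inverse_le[of "norm (h - f)" "\<epsilon> / 3"] \<open>0 < \<epsilon>\<close>
      by (simp add: dist_norm)
  qed
  ultimately show "\<exists>d>0. \<forall>f\<in>dual_space sc. \<forall>h\<in>dual_space sc. dist h f < d \<longrightarrow>
      dist (ball_cut h) (ball_cut f) < \<epsilon>"
    by blast
qed

text \<open>The multiplier that is admissible for \<open>f\<close> is also admissible for the first \<open>n\<close> coordinates of \<open>f\<close>:
  either it keeps all of them, or it has dropped to \<open>0\<close> before the remaining ones enter.\<close>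

lemma ball_cut_cut_ramp:
  assumes f: "f \<in> dual_space sc"
  shows "ball_cut (cut (ramp (real n)) f) = cut (ramp (real n)) (ball_cut f)"
proof -
  let ?p = "ramp (real n)"
  obtain s where s: "normalizing f s" and r: "ball_cut f = cut s f"
    using ball_cut_some[OF f] by blast
  have cutoffs: "cutoff s" "cutoff ?p"
    using s by (auto simp: normalizing_def cutoff_ramp)
  note facts = f cutoffs cut_in_dual cut_e
  have commute: "cut s (cut ?p f) = cut ?p (cut s f)"
    by (intro cut_commute facts)
  have small: "norm (cut s (cut ?p f)) \<le> 1"
    unfolding commute using norm_cut_le[OF cutoffs(2), of "cut s f"] s by (simp add: normalizing_def)
  have "(\<forall>j<n. s j = 1) \<or> (\<forall>j\<ge>n. s j = 0)"
  proof -
    have "(\<forall>j<n. ramp \<tau> j = 1) \<or> (\<forall>j\<ge>n. ramp \<tau> j = 0)" for \<tau>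
      by (cases "real n \<le> \<tau>") (auto simp: ramp_def)
    then show ?thesis
      using cutoffs(1) by (auto simp: cutoff_def)
  qed
  then have "normalizing (cut ?p f) s"
  proof
    assume "\<forall>j<n. s j = 1"
    then have "cut s (cut ?p f) = cut ?p f"
      by (intro dual_eqI) (auto simp: facts ramp_of_nat)
    with small cutoffs show ?thesis
      by (simp add: normalizing_def)
  next
    assume "\<forall>j\<ge>n. s j = 0"
    then have "cut s (cut ?p f) = cut s f"
      by (intro dual_eqI) (auto simp: facts ramp_of_nat)
    moreover from this have "cut s (cut ?p f) = cut ?p f" if "cut s f = f"
      using that commute by simp
    ultimately show ?thesis
      using s small by (auto simp: normalizing_def)
  qed
  then show ?thesis
    using ball_cut_eqI[OF cut_in_dual[OF cutoffs(2) f]] by (simp add: r commute)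
qed

text \<open>It suffices to evaluate at each \<open>x\<close>. There \<open>ball_cut f\<close> is the uniform limit of its initial parts,
  each of which is the norm continuous map \<open>ball_cut\<close> applied to an initial part of \<open>f\<close>.\<close>

lemma ball_cut_weak_star_continuous:
  "continuous_map (weak_star_topology sc) (weak_star_topology sc) ball_cut"
proof -
  have eval: "continuous_map (weak_star_topology sc) euclidean (\<lambda>f. blinfun_apply (ball_cut f) x)" for x
  proof -
    let ?p = "\<lambda>n. ramp (real n)"
    have approx: "continuous_map (weak_star_topology sc) euclidean
        (\<lambda>f. blinfun_apply (ball_cut (cut (?p n) f)) x)" for n
    proof -
      have "continuous_map (weak_star_topology sc) (top_of_set (dual_space sc)) (cut (?p n))"
        using continuous_map_weak_star_cut_ramp
        by (auto simp: continuous_map_in_subtopology topspace_weak_star cut_in_dual cutoff_ramp)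
      from continuous_map_compose[OF this] have "continuous_map (weak_star_topology sc) euclidean
          (g \<circ> cut (?p n))" if "continuous_map (top_of_set (dual_space sc)) euclidean g" for g :: "('a \<Rightarrow>\<^sub>L 'k) \<Rightarrow> 'k"
        using that .
      moreover have "continuous_map (top_of_set (dual_space sc)) euclidean (\<lambda>f. blinfun_apply (ball_cut f) x)"
        using uniformly_continuous_imp_continuous[OF ball_cut_uniformly_continuous]
        by (auto intro!: continuous_intros)
      ultimately show ?thesis
        unfolding o_def by blast
    qed
    have "continuous_map (weak_star_topology sc) Met_TC.mtopology (\<lambda>f. blinfun_apply (ball_cut f) x)"
    proof (rule Met_TC.continuous_map_uniform_limit[where F = sequentially])
      show "\<forall>\<^sub>F n in sequentially. continuous_map (weak_star_topology sc) Met_TC.mtopology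
          (\<lambda>f. blinfun_apply (ball_cut (cut (?p n) f)) x)"
        using approx by simp
      fix \<epsilon> :: real assume "0 < \<epsilon>"
      then have "\<forall>\<^sub>F n in sequentially. dist (\<Sum>j<n. sc (coord x j) (e j)) x < \<epsilon>"
        using coord_sums[of x] unfolding sums_def by (rule tendstoD[rotated])
      then show "\<forall>\<^sub>F n in sequentially. \<forall>f\<in>topspace (weak_star_topology sc).
          blinfun_apply (ball_cut f) x \<in> UNIV \<and>
          dist (blinfun_apply (ball_cut (cut (?p n) f)) x) (blinfun_apply (ball_cut f) x) < \<epsilon>"
      proof (rule eventually_mono, intro ballI conjI UNIV_I)
        fix n f
        assume n: "dist (\<Sum>j<n. sc (coord x j) (e j)) x < \<epsilon>"
          and "f \<in> topspace (weak_star_topology sc)"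
        then have f: "f \<in> dual_space sc"
          by (simp add: topspace_weak_star)
        define g where "g = ball_cut f"
        have g: "g \<in> dual_space sc" "norm g \<le> 1"
          using ball_cut_in_ball[OF f] by (auto simp: g_def dual_ball_def)
        have "blinfun_apply (ball_cut (cut (?p n) f)) x = blinfun_apply g (\<Sum>j<n. sc (coord x j) (e j))"
          using g by (simp add: ball_cut_cut_ramp[OF f] flip: g_def)
            (simp add: cut_ramp_apply blinfun.sum_right dual_space_sc)
        then have "dist (blinfun_apply (ball_cut (cut (?p n) f)) x) (blinfun_apply g x)
            \<le> norm g * norm ((\<Sum>j<n. sc (coord x j) (e j)) - x)"
          using norm_blinfun[of g "(\<Sum>j<n. sc (coord x j) (e j)) - x"]
          by (simp add: dist_norm blinfun.diff_right)
        also have "\<dots> \<le> 1 * norm ((\<Sum>j<n. sc (coord x j) (e j)) - x)"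
          using g by (intro mult_right_mono) auto
        also have "\<dots> < \<epsilon>"
          using n by (simp add: dist_norm)
        finally show "dist (blinfun_apply (ball_cut (cut (?p n) f)) x) (blinfun_apply (ball_cut f) x) < \<epsilon>"
          by (simp add: g_def)
      qed
    qed simp
    then show ?thesis
      by simp
  qed
  then have "continuous_map (weak_star_topology sc) strong_operator_topology ball_cut"
    by (subst continuous_on_strong_operator_topo_iff_coordinatewise) simp
  then show ?thesis
    unfolding weak_star_topology_def[of sc] continuous_map_in_subtopology
    using ball_cut_in_ball by (auto simp: dual_ball_def weak_star_topology_def strong_operator_topology_topspace)
qed

lemma ball_cut_retraction: "uniformly_simultaneously_continuous_retraction sc ball_cut"
  unfolding uniformly_simultaneously_continuous_retraction_def
  using ball_cut_in_ball ball_cut_ball ball_cut_weak_star_continuous ball_cut_uniformly_continuous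
  by blast

end

lemma modulus_of_continuity_ball_cut_le:
  assumes "0 < t"
  shows "modulus_of_continuity (dual_space sc) ball_cut t \<le> 2 * modulus_inverse modulus t"
  unfolding modulus_of_continuity_def
proof (rule cSup_least)
  have "(0 :: 'a \<Rightarrow>\<^sub>L 'k) \<in> dual_space sc"
    by (simp add: dual_space_def)
  with assms show "{norm (ball_cut x - ball_cut y) | x y.
      x \<in> dual_space sc \<and> y \<in> dual_space sc \<and> norm (x - y) \<le> t} \<noteq> {}"
    by (intro ex_in_conv[THEN iffD1] exI[of _ 0]) (auto intro!: exI[of _ 0])
  show "c \<le> 2 * modulus_inverse modulus t" if "c \<in> {norm (ball_cut x - ball_cut y) | x y.
      x \<in> dual_space sc \<and> y \<in> dual_space sc \<and> norm (x - y) \<le> t}"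
    (is "c \<in> ?D") for c
  proof -
    obtain x y where xy: "x \<in> dual_space sc" "y \<in> dual_space sc" "norm (x - y) \<le> t"
      and c: "c = norm (ball_cut x - ball_cut y)"
      using \<open>c \<in> ?D\<close> by blast
    show ?thesis
      using norm_ball_cut_diff_le[OF xy] self_le_modulus_inverse[of t] assms by (simp add: c)
  qed
qed

end

theorem theorem2p1:
  fixes sc :: "'k::real_normed_field \<Rightarrow> 'a::banach \<Rightarrow> 'a"
    and e :: "nat \<Rightarrow> 'a"
    and M :: "real \<Rightarrow> real"
  assumes "banach_space_over sc"
    and "unconditional_basis sc e"
    and "\<forall>j. norm (e j) = 1"
    and "unconditional_basis_constant sc e = 1"
    and "uniformly_monotone (dual_space sc) (dual_abs sc e)"
    and "M = monotonicity_modulus (dual_space sc) (dual_abs sc e)"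
  shows "\<exists>\<phi>. uniformly_simultaneously_continuous_retraction sc \<phi> \<and>
           (\<forall>t>0. modulus_of_continuity (dual_space sc) \<phi> t \<le> 2 * modulus_inverse M t)"
proof -
  interpret one_unconditional_basis sc e
    using assms(1-4)
    by (intro one_unconditional_basis.intro one_unconditional_basis_axioms.intro)
      (simp_all add: unconditional_basis_def)
  show ?thesis
    using ball_cut_retraction[OF assms(5)] modulus_of_continuity_ball_cut_le
    unfolding assms(6) by blast
qed

end
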